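(* Let $k\ge 1$ and let $\Delta$ be a convex union representable simplicial complex that has $k$ facets $\sigma_1,\dots,\sigma_k$ such that every free face of $\Delta$ is contained in at least one of $\sigma_1,\dots,\sigma_k$. Then $\Delta$ is $(k-1)$-convex union representable.
   Context: A simplicial complex on a finite ground set is a collection $\Delta$ of subsets (faces) closed under inclusion; elements of the ground set need not be vertices. Facets are inclusion-maximal faces. A face that is not a facet is free if it is contained in a unique facet (the empty face may be free). For a collection $\mathcal U=\{U_1,\dots,U_n\}$ of convex subsets of $\mathbb R^d$ (the empty set is convex, open and closed), put $U_\sigma=\bigcap_{i\in\sigma}U_i$ for $\emptyset\ne\sigma\subseteq[n]$ and $U_\emptyset=\operatorname{conv}(\bigcup_i U_i)$. The nerve is $\mathcal N(\mathcal U)=\{\sigma\subseteq[n]\mid U_\sigma\neq\emptyset\}$ (so it is the void complex with no faces if all $U_i$ are empty). A complex $\Delta\subseteq 2^{[n]}$ is $d$-convex union representable ($d\ge 0$ an integer; $\mathbb R^0$ is a point) if $\Delta=\mathcal N(\mathcal U)$ for some collection $\mathcal U=\{U_i\}_{i=1}^n$ of convex open sets in $\mathbb R^d$ whose union is convex. It is convex union representable if it is $d$-convex union representable for some $d$. *)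

theory Defs
  imports "HOL-Analysis.Analysis" "HOL-Library.Function_Algebras"
begin

text \<open>
  Euclidean $d$-space, for a natural number $d$ that has to be quantified inside formulas, is
  \<^const>\<open>Euclidean_space\<close> \<open>d\<close>: the sequences \<open>x :: nat \<Rightarrow> real\<close> with \<open>x i = 0\<close> for all \<open>i \<ge> d\<close>
  (a single point for \<open>d = 0\<close>). The pointwise vector space structure on functions makes
  \<^const>\<open>convex\<close> and \<open>convex hull\<close> available on these sequences.
\<close>

instantiation "fun" :: (type, real_vector) real_vector
begin

definition scaleR_fun :: "real \<Rightarrow> ('a \<Rightarrow> 'b) \<Rightarrow> 'a \<Rightarrow> 'b" where
  "scaleR_fun c f = (\<lambda>x. c *\<^sub>R f x)"

instance
  by standard (simp_all add: scaleR_fun_def fun_eq_iff scaleR_add_right scaleR_add_left)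

end

lemma scaleR_fun_apply [simp]: "(c *\<^sub>R f) x = c *\<^sub>R f x"
  by (simp add: scaleR_fun_def)

text \<open>Elements of the ground set \<open>V\<close> need not be vertices, and the complex may have no faces at all.\<close>

definition simplicial_complex_on :: "'v set \<Rightarrow> 'v set set \<Rightarrow> bool" where
  "simplicial_complex_on V \<Delta> \<longleftrightarrow>
     finite V \<and> \<Delta> \<subseteq> Pow V \<and> (\<forall>\<sigma>\<in>\<Delta>. \<forall>\<tau>. \<tau> \<subseteq> \<sigma> \<longrightarrow> \<tau> \<in> \<Delta>)"

definition facet :: "'v set set \<Rightarrow> 'v set \<Rightarrow> bool" where
  "facet \<Delta> \<sigma> \<longleftrightarrow> \<sigma> \<in> \<Delta> \<and> (\<forall>\<tau>\<in>\<Delta>. \<sigma> \<subseteq> \<tau> \<longrightarrow> \<tau> = \<sigma>)"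

definition free_face :: "'v set set \<Rightarrow> 'v set \<Rightarrow> bool" where
  "free_face \<Delta> \<sigma> \<longleftrightarrow> \<sigma> \<in> \<Delta> \<and> \<not> facet \<Delta> \<sigma> \<and> (\<exists>!\<phi>. facet \<Delta> \<phi> \<and> \<sigma> \<subseteq> \<phi>)"

definition nerve_inter :: "'v set \<Rightarrow> ('v \<Rightarrow> (nat \<Rightarrow> real) set) \<Rightarrow> 'v set \<Rightarrow> (nat \<Rightarrow> real) set" where
  "nerve_inter V U \<sigma> = (if \<sigma> = {} then convex hull (\<Union>i\<in>V. U i) else (\<Inter>i\<in>\<sigma>. U i))"

definition nerve :: "'v set \<Rightarrow> ('v \<Rightarrow> (nat \<Rightarrow> real) set) \<Rightarrow> 'v set set" where
  "nerve V U = {\<sigma>. \<sigma> \<subseteq> V \<and> nerve_inter V U \<sigma> \<noteq> {}}"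

definition convex_union_representable_dim :: "nat \<Rightarrow> 'v set \<Rightarrow> 'v set set \<Rightarrow> bool" where
  "convex_union_representable_dim d V \<Delta> \<longleftrightarrow>
     (\<exists>U :: 'v \<Rightarrow> (nat \<Rightarrow> real) set.
        (\<forall>i\<in>V. openin (Euclidean_space d) (U i) \<and> convex (U i)) \<and>
        convex (\<Union>i\<in>V. U i) \<and>
        \<Delta> = nerve V U)"

definition convex_union_representable :: "'v set \<Rightarrow> 'v set set \<Rightarrow> bool" where
  "convex_union_representable V \<Delta> \<longleftrightarrow> (\<exists>d. convex_union_representable_dim d V \<Delta>)"

end

theory Submission
  imports Defs
begin

text \<open>
  Let \<open>\<Delta>\<close> be the nerve of open convex sets \<open>U i\<close> with convex union, and choose for each of
  the \<open>k\<close> given facets a point that lies in all the sets \<open>U i\<close> indexed by that facet. The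
  claim is that every common part \<open>\<Inter>i\<in>\<tau>. U i\<close> of a face \<open>\<tau>\<close> meets the convex hull \<open>D\<close> of the
  \<open>k\<close> chosen points (\<open>faces_meet_hull_of_facet_points\<close>). Then pulling the \<open>U i\<close> back along an
  affine map from \<open>(k - 1)\<close>-space whose image contains \<open>D\<close> preserves openness, convexity,
  convexity of the union and the nerve.

  Suppose that the common part of \<open>\<tau>\<close> misses \<open>D\<close>. The \<open>U i\<close> are first shrunk to compact convex
  sets \<open>K i\<close> with convex union and the same nerve (\<open>compact_convex_shrinking\<close>). A ball around
  some \<open>a\<close>, so large that it is nearly a half-space, contains \<open>D\<close> and misses the common part of
  \<open>\<tau>\<close>. Let the ball grow until it has touched the common parts of all faces. Balls
  are strictly convex, so the common part that is touched last is touched in a single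
  point \<open>p\<close>, and \<open>\<sigma> = {i. p \<in> K i}\<close> is the only facet that contains a minimal face \<open>\<rho>\<close> that is
  touched last. If \<open>\<rho> \<noteq> \<sigma>\<close>, then \<open>\<rho>\<close> is free. Its common part misses the original ball, whereas a
  free face lies in one of the given facets, whose chosen point lies in that ball: a contradiction.

  That \<open>\<rho> = \<sigma>\<close> cannot happen is where convexity of the union is used. In this case
  the sets \<open>K i\<close> with \<open>i \<in> \<sigma>\<close> cover the union near \<open>p\<close>, any \<open>card \<sigma> - 1\<close> of them have
  common points near \<open>p\<close> and closer to \<open>a\<close>, and Berge's intersection theorem
  (\<open>Berge_intersection\<close>) gives such a point for all of them, which contradicts the choice of \<open>p\<close>.

  Balls with these properties need an inner product, and the dimension of the ambient space is
  a variable. The argument therefore takes place in the inner product space of finitely supported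
  sequences, which contains a copy of every Euclidean space.
\<close>

section \<open>The inner product space of finitely supported sequences\<close>

text \<open>
  One fixed inner product space that projects linearly and continuously onto \<open>\<real>\<^sup>d\<close> for every \<open>d\<close>,
  so that a type can serve as ambient space although \<open>d\<close> is a variable.
\<close>

typedef fin_seq = "{x :: nat \<Rightarrow> real. finite {i. x i \<noteq> 0}}"
  morphisms coord Fin_seq
  by (rule exI[of _ "\<lambda>i. 0"]) simp

setup_lifting type_definition_fin_seq

lemma finite_support: "finite {i. coord x i \<noteq> 0}"
  using coord[of x] by simp

lemma fin_seq_eqI: "(\<And>i. coord x i = coord y i) \<Longrightarrow> x = y"
  by (meson coord_inject ext)

instantiation fin_seq :: real_inner
begin

lift_definition zero_fin_seq :: fin_seq is "\<lambda>i. 0" by simp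

lift_definition plus_fin_seq :: "fin_seq \<Rightarrow> fin_seq \<Rightarrow> fin_seq" is "\<lambda>x y i. x i + y i"
  by (erule (1) rev_finite_subset[OF finite_UnI]) auto

lift_definition minus_fin_seq :: "fin_seq \<Rightarrow> fin_seq \<Rightarrow> fin_seq" is "\<lambda>x y i. x i - y i"
  by (erule (1) rev_finite_subset[OF finite_UnI]) auto

lift_definition uminus_fin_seq :: "fin_seq \<Rightarrow> fin_seq" is "\<lambda>x i. - x i"
  by simp

lift_definition scaleR_fin_seq :: "real \<Rightarrow> fin_seq \<Rightarrow> fin_seq" is "\<lambda>c x i. c * x i"
  by (erule rev_finite_subset) auto

definition inner_fin_seq :: "fin_seq \<Rightarrow> fin_seq \<Rightarrow> real" where
  "inner_fin_seq x y = (\<Sum>i | coord x i \<noteq> 0 \<and> coord y i \<noteq> 0. coord x i * coord y i)"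

definition norm_fin_seq :: "fin_seq \<Rightarrow> real" where
  "norm_fin_seq x = sqrt (inner x x)"

definition sgn_fin_seq :: "fin_seq \<Rightarrow> fin_seq" where
  "sgn_fin_seq x = inverse (norm x) *\<^sub>R x"

definition dist_fin_seq :: "fin_seq \<Rightarrow> fin_seq \<Rightarrow> real" where
  "dist_fin_seq x y = norm (x - y)"

definition uniformity_fin_seq :: "(fin_seq \<times> fin_seq) filter" where
  "uniformity_fin_seq = (INF e\<in>{0<..}. principal {(x, y). dist x y < e})"

definition open_fin_seq :: "fin_seq set \<Rightarrow> bool" where
  "open_fin_seq U \<longleftrightarrow> (\<forall>x\<in>U. eventually (\<lambda>(x', y). x' = x \<longrightarrow> y \<in> U) uniformity)"

text \<open>
  Extending the sum to a range that does not depend on one of the arguments makes bilinearity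
  a matter of summing termwise.
\<close>

lemma inner_fin_seq_superset:
  assumes "finite I" "{i. coord x i \<noteq> 0 \<and> coord y i \<noteq> 0} \<subseteq> I"
  shows "inner x y = (\<Sum>i\<in>I. coord x i * coord y i)"
  unfolding inner_fin_seq_def using assms by (intro sum.mono_neutral_left) auto

instance
proof
  fix a b :: real and x y z :: fin_seq
  show "dist x y = norm (x - y)" by (rule dist_fin_seq_def)
  show "x + y + z = x + (y + z)" by transfer (simp add: add.assoc)
  show "x + y = y + x" by transfer (simp add: add.commute)
  show "0 + x = x" by transfer simp
  show "- x + x = 0" by transfer simp
  show "x - y = x + - y" by transfer simp
  show "a *\<^sub>R (x + y) = a *\<^sub>R x + a *\<^sub>R y" by transfer (simp add: distrib_left)
  show "(a + b) *\<^sub>R x = a *\<^sub>R x + b *\<^sub>R x" by transfer (simp add: distrib_right)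
  show "a *\<^sub>R b *\<^sub>R x = (a * b) *\<^sub>R x" by transfer (simp add: mult.assoc)
  show "1 *\<^sub>R x = x" by transfer simp
  show "sgn x = inverse (norm x) *\<^sub>R x" by (rule sgn_fin_seq_def)
  show "uniformity = (INF e\<in>{0<..}. principal {(x, y). dist (x :: fin_seq) y < e})"
    by (rule uniformity_fin_seq_def)
  show "open U \<longleftrightarrow> (\<forall>x\<in>U. eventually (\<lambda>(x', y). x' = x \<longrightarrow> y \<in> U) uniformity)"
    for U :: "fin_seq set" by (rule open_fin_seq_def)
  show "inner x y = inner y x"
    by (simp add: inner_fin_seq_def mult.commute conj_commute)
  show "inner (a *\<^sub>R x) y = a * inner x y"
    by (subst (1 2) inner_fin_seq_superset[OF finite_support[of y]])
      (auto simp: scaleR_fin_seq.rep_eq sum_distrib_left mult.assoc)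
  show "inner (x + y) z = inner x z + inner y z"
    by (subst (1 2 3) inner_fin_seq_superset[OF finite_support[of z]])
      (auto simp: plus_fin_seq.rep_eq sum.distrib distrib_right)
  have *: "inner x x = (\<Sum>i | coord x i \<noteq> 0. coord x i * coord x i)"
    by (simp add: inner_fin_seq_def)
  show "0 \<le> inner x x" unfolding * by (intro sum_nonneg) simp
  show "inner x x = 0 \<longleftrightarrow> x = 0"
  proof
    assume "inner x x = 0"
    then have "\<forall>i\<in>{i. coord x i \<noteq> 0}. coord x i * coord x i = 0"
      unfolding * by (subst (asm) sum_nonneg_eq_0_iff) (auto simp: finite_support)
    then show "x = 0" by (intro fin_seq_eqI) (auto simp: zero_fin_seq.rep_eq)
  qed (simp add: inner_fin_seq_def zero_fin_seq.rep_eq)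
  show "norm x = sqrt (inner x x)" by (rule norm_fin_seq_def)
qed

end

lemma abs_coord_le_norm: "\<bar>coord x i\<bar> \<le> norm x"
proof -
  have "(coord x i)\<^sup>2 \<le> inner x x"
  proof -
    have "(\<Sum>j\<in>{i}. coord x j * coord x j) \<le> (\<Sum>j\<in>insert i {j. coord x j \<noteq> 0}. coord x j * coord x j)"
      by (rule sum_mono2) (auto simp: finite_support)
    also have "\<dots> = inner x x"
      by (rule inner_fin_seq_superset[symmetric]) (auto simp: finite_support)
    finally show ?thesis by (simp add: power2_eq_square)
  qed
  then show ?thesis by (simp add: norm_fin_seq_def real_le_rsqrt)
qed

lemma bounded_linear_coord: "bounded_linear (\<lambda>x. coord x i)"
  by (rule bounded_linear_intro[where K = 1])
    (simp_all add: plus_fin_seq.rep_eq scaleR_fin_seq.rep_eq abs_coord_le_norm)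

section \<open>Separation and Berge's intersection theorem\<close>

text \<open>
  The difference set of \<open>T\<close> and \<open>S\<close> is compact, convex and misses the origin; its point nearest to
  the origin is a normal vector. Compactness of both sets replaces completeness of the space, so
  that the result holds in every inner product space.
\<close>

lemma compact_convex_separation:
  fixes S T :: "'a :: real_inner set"
  assumes S: "compact S" "convex S" and T: "compact T" "convex T"
    and disj: "S \<inter> T = {}" and ne: "S \<noteq> {}" "T \<noteq> {}"
  obtains u c where "\<And>x. x \<in> S \<Longrightarrow> u \<bullet> x < c" "\<And>y. y \<in> T \<Longrightarrow> c < u \<bullet> y"
proof -
  define D where "D = (\<Union>y\<in>T. \<Union>x\<in>S. {y - x})"
  have D: "compact D" "convex D" "D \<noteq> {}"
    unfolding D_def using S T ne by (auto intro: compact_differences' convex_differences)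
  have "0 \<notin> D" using disj by (auto simp: D_def)
  have "\<exists>z\<in>D. \<forall>w\<in>D. dist 0 z \<le> dist 0 w"
    by (rule continuous_attains_inf) (use D in \<open>auto intro!: continuous_intros\<close>)
  then obtain z where z: "z \<in> D" "\<forall>w\<in>D. dist 0 z \<le> dist 0 w" by blast
  have "z \<noteq> 0" using z \<open>0 \<notin> D\<close> by auto
  then have pos: "0 < z \<bullet> z" by simp
  have sep: "z \<bullet> z \<le> z \<bullet> y - z \<bullet> x" if "x \<in> S" "y \<in> T" for x y
  proof -
    have "y - x \<in> D" using that by (auto simp: D_def)
    from any_closest_point_dot[OF D(2) compact_imp_closed[OF D(1)] z(1) this z(2)]
    show ?thesis by (simp add: inner_diff_right)
  qed
  have "\<exists>x\<in>S. \<forall>y\<in>S. z \<bullet> y \<le> z \<bullet> x"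
    by (rule continuous_attains_sup) (use S ne in \<open>auto intro!: continuous_intros\<close>)
  then obtain s where s: "s \<in> S" "\<And>x. x \<in> S \<Longrightarrow> z \<bullet> x \<le> z \<bullet> s" by blast
  show thesis
  proof (rule that[of z "z \<bullet> s + (z \<bullet> z) / 2"])
    show "z \<bullet> x < z \<bullet> s + (z \<bullet> z) / 2" if "x \<in> S" for x
      using s(2)[OF that] pos by linarith
    show "z \<bullet> s + (z \<bullet> z) / 2 < z \<bullet> y" if "y \<in> T" for y
      using sep[OF s(1) that] pos by linarith
  qed
qed

text \<open>
  A separating hyperplane is replaced by a sphere of large radius with the same normal. The squared
  distance to \<open>- M *\<^sub>R u\<close> is \<open>norm x ^ 2 + 2 * M * (u \<bullet> x)\<close> up to a constant; for large \<open>M\<close> the linear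
  term outweighs the quadratic one, which is bounded on \<open>S\<close> and nonnegative on \<open>T\<close>.
\<close>

lemma compact_convex_separation_by_ball:
  fixes S T :: "'a :: real_inner set"
  assumes S: "compact S" "convex S" and T: "compact T" "convex T"
    and disj: "S \<inter> T = {}" and ne: "S \<noteq> {}" "T \<noteq> {}"
  obtains a r where "S \<subseteq> ball a r" "T \<inter> ball a r = {}"
proof -
  obtain u c where u: "\<And>x. x \<in> S \<Longrightarrow> u \<bullet> x < c" "\<And>y. y \<in> T \<Longrightarrow> c < u \<bullet> y"
    using compact_convex_separation[OF assms] by blast
  have "\<exists>x\<in>S. \<forall>y\<in>S. u \<bullet> y \<le> u \<bullet> x"
    by (rule continuous_attains_sup) (use S ne in \<open>auto intro!: continuous_intros\<close>)
  then obtain s where s: "s \<in> S" "\<And>x. x \<in> S \<Longrightarrow> u \<bullet> x \<le> u \<bullet> s" by blast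
  have "\<exists>x\<in>S. \<forall>y\<in>S. y \<bullet> y \<le> x \<bullet> x"
    by (rule continuous_attains_sup) (use S ne in \<open>auto intro!: continuous_intros\<close>)
  then obtain b :: 'a where b: "\<And>x. x \<in> S \<Longrightarrow> x \<bullet> x \<le> b \<bullet> b" by metis
  define e where "e = c - u \<bullet> s"
  have e: "e > 0" using u(1)[OF s(1)] by (simp add: e_def)
  \<comment> \<open>This choice makes the gap \<open>2 * M * e\<close> of the linear term exceed the bound of the quadratic term on \<open>S\<close>.\<close>
  define M where "M = (b \<bullet> b + 1) / (2 * e)"
  have M: "M > 0" "2 * (M * e) = b \<bullet> b + 1"
    using e by (auto simp: M_def add_nonneg_pos)
  define a where "a = - (M *\<^sub>R u)"
  define R where "R = 2 * (M * c) + a \<bullet> a"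
  have d: "(dist a x)\<^sup>2 = x \<bullet> x + 2 * (M * (u \<bullet> x)) + a \<bullet> a" for x
    unfolding dist_norm power2_norm_eq_inner
    by (simp add: a_def inner_diff_left inner_diff_right inner_commute algebra_simps)
  have in_S: "(dist a x)\<^sup>2 < R" if "x \<in> S" for x
  proof -
    have "M * (u \<bullet> x) \<le> M * (c - e)"
      using s(2)[OF that] M(1) by (intro mult_left_mono) (auto simp: e_def)
    then show ?thesis using b[OF that] M(2) unfolding d R_def by (simp add: right_diff_distrib)
  qed
  have in_T: "R \<le> (dist a y)\<^sup>2" if "y \<in> T" for y
  proof -
    have "M * c \<le> M * (u \<bullet> y)" using u(2)[OF that] M(1) by (intro mult_left_mono) auto
    moreover have "0 \<le> y \<bullet> y" by simp
    ultimately show ?thesis unfolding d R_def by linarith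
  qed
  show thesis
  proof (rule that[of a "sqrt R"])
    show "S \<subseteq> ball a (sqrt R)" using in_S by (auto simp: real_less_rsqrt)
    show "T \<inter> ball a (sqrt R) = {}"
    proof (rule ccontr)
      assume "T \<inter> ball a (sqrt R) \<noteq> {}"
      then obtain y where y: "y \<in> T" "dist a y < sqrt R" by auto
      from in_T[OF y(1)] have "sqrt R \<le> dist a y" by (rule real_le_lsqrt[OF zero_le_dist])
      with y(2) show False by simp
    qed
  qed
qed

text \<open>
  If the common point were missing, a hyperplane \<open>H\<close> would separate \<open>A n\<close> from the common part of
  the other sets. It meets each segment from \<open>q j\<close> to \<open>q n\<close>, and these crossing points satisfy the
  hypotheses for the family without \<open>A n\<close>, whose common part would therefore meet \<open>H\<close>. In Berge's
  formulation the union of the sets is convex and each subfamily that omits one set has a common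
  point; \<open>q j\<close> is such a point when \<open>A j\<close> is omitted, and covering the hull of these points suffices.
\<close>

lemma Berge_intersection:
  fixes A :: "'i \<Rightarrow> 'a :: real_inner set" and q :: "'i \<Rightarrow> 'a"
  assumes "finite I" "I \<noteq> {}"
    and "\<And>i. i \<in> I \<Longrightarrow> closed (A i)" "\<And>i. i \<in> I \<Longrightarrow> convex (A i)"
    and "\<And>i j. i \<in> I \<Longrightarrow> j \<in> I \<Longrightarrow> i \<noteq> j \<Longrightarrow> q j \<in> A i"
    and "convex hull (q ` I) \<subseteq> (\<Union>i\<in>I. A i)"
  shows "convex hull (q ` I) \<inter> (\<Inter>i\<in>I. A i) \<noteq> {}"
  using assms
proof (induction I arbitrary: q rule: finite_ne_induct)
  case (singleton i)
  then show ?case by auto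
next
  case (insert n I)
  define X where "X = convex hull (q ` insert n I)"
  have X: "compact X" "convex X"
    unfolding X_def using insert.hyps by (auto intro: finite_imp_compact_convex_hull)
  have qX: "q j \<in> X" if "j \<in> insert n I" for j
    unfolding X_def using that by (intro hull_inc) auto
  define S T where "S = X \<inter> A n" and "T = X \<inter> (\<Inter>i\<in>I. A i)"
  show ?case
  proof (rule ccontr)
    assume "\<not> ?thesis"
    then have "S \<inter> T = {}" by (auto simp: S_def T_def X_def)
    moreover have S: "compact S" "convex S"
      unfolding S_def using X insert.prems by (auto intro: compact_Int_closed convex_Int)
    moreover have T: "compact T" "convex T"
      unfolding T_def using X insert.prems
      by (auto intro!: compact_Int_closed convex_Int convex_INT)
    moreover have qn: "q n \<in> T" and qS: "\<And>j. j \<in> I \<Longrightarrow> q j \<in> S"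
      unfolding S_def T_def using insert.prems(3) insert.hyps(3) qX by blast+
    moreover have "S \<noteq> {}" using qS insert.hyps(2) by auto
    moreover have "T \<noteq> {}" using qn by auto
    ultimately obtain u c where u: "\<And>x. x \<in> S \<Longrightarrow> u \<bullet> x < c" "\<And>y. y \<in> T \<Longrightarrow> c < u \<bullet> y"
      using compact_convex_separation[of S T] by blast
    define H where "H = {x. u \<bullet> x = c}"
    have "\<exists>p. p \<in> H \<and> p \<in> closed_segment (q j) (q n)" if "j \<in> I" for j
      using connected_ivt_hyperplane[OF connected_segment(1), of "q j" "q j" "q n" "q n" u c]
        u(1)[OF qS[OF that]] u(2)[OF qn] by (auto simp: H_def)
    then obtain p where p: "\<And>j. j \<in> I \<Longrightarrow> p j \<in> H" "\<And>j. j \<in> I \<Longrightarrow> p j \<in> closed_segment (q j) (q n)"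
      by metis
    have pX: "p j \<in> X" if "j \<in> I" for j
      using closed_segment_subset[OF qX qX X(2), of j n] p(2) that by auto
    have hull_X: "convex hull (p ` I) \<subseteq> X"
      by (rule hull_minimal) (use pX X in auto)
    have hull_H: "convex hull (p ` I) \<subseteq> H"
      by (rule hull_minimal) (use p(1) in \<open>auto simp: H_def convex_hyperplane\<close>)
    have "convex hull (p ` I) \<inter> (\<Inter>i\<in>I. A i) \<noteq> {}"
    proof (rule insert.IH)
      show "closed (A i)" "convex (A i)" if "i \<in> I" for i using insert.prems that by auto
      show "p j \<in> A i" if "i \<in> I" "j \<in> I" "i \<noteq> j" for i j
      proof -
        have "q j \<in> A i" "q n \<in> A i" "convex (A i)"
          using insert.prems that insert.hyps(3) by (metis insertCI)+
        then show ?thesis using closed_segment_subset p(2)[OF that(2)] by blast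
      qed
      show "convex hull (p ` I) \<subseteq> (\<Union>i\<in>I. A i)"
      proof
        fix x assume x: "x \<in> convex hull (p ` I)"
        then have "x \<in> X" "u \<bullet> x = c" using hull_X hull_H by (auto simp: H_def)
        moreover from this have "x \<notin> A n" using u(1)[of x] by (auto simp: S_def)
        ultimately show "x \<in> (\<Union>i\<in>I. A i)" using insert.prems(4) by (auto simp: X_def)
      qed
    qed
    then obtain z where "z \<in> convex hull (p ` I)" "\<And>i. i \<in> I \<Longrightarrow> z \<in> A i" by blast
    then have "z \<in> T" "u \<bullet> z = c" using hull_X hull_H by (auto simp: T_def H_def)
    then show False using u(2)[of z] by simp
  qed
qed

section \<open>Shrinking a convex cover without changing its nerve\<close>

text \<open>
  Intersecting with the union makes the common part of the empty face the whole union. This is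
  \<^const>\<open>nerve_inter\<close> in the case of a convex union, but for sets in an arbitrary space.
\<close>

definition common_part :: "'v set \<Rightarrow> ('v \<Rightarrow> 'a set) \<Rightarrow> 'v set \<Rightarrow> 'a set" where
  "common_part V A \<rho> = {x \<in> (\<Union>i\<in>V. A i). \<forall>i\<in>\<rho>. x \<in> A i}"

definition nerve_of :: "'v set \<Rightarrow> ('v \<Rightarrow> 'a set) \<Rightarrow> 'v set set" where
  "nerve_of V A = {\<rho>. \<rho> \<subseteq> V \<and> common_part V A \<rho> \<noteq> {}}"

lemma common_part_antimono: "\<rho> \<subseteq> \<tau> \<Longrightarrow> common_part V A \<tau> \<subseteq> common_part V A \<rho>"
  by (auto simp: common_part_def)

lemma convex_common_part:
  assumes "convex (\<Union>i\<in>V. A i)" "\<And>i. i \<in> V \<Longrightarrow> convex (A i)" "\<rho> \<subseteq> V"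
  shows "convex (common_part V A \<rho>)"
proof -
  have "common_part V A \<rho> = (\<Union>i\<in>V. A i) \<inter> (\<Inter>i\<in>\<rho>. A i)" by (auto simp: common_part_def)
  with assms show ?thesis by (auto intro!: convex_Int convex_INT)
qed

lemma compact_common_part:
  fixes A :: "'v \<Rightarrow> 'a :: metric_space set"
  assumes "finite V" "\<And>i. i \<in> V \<Longrightarrow> compact (A i)" "\<rho> \<subseteq> V"
  shows "compact (common_part V A \<rho>)"
proof -
  have "common_part V A \<rho> = (\<Union>i\<in>V. A i) \<inter> (\<Inter>i\<in>\<rho>. A i)" by (auto simp: common_part_def)
  moreover have "compact (\<Union>i\<in>V. A i)" using assms by (intro compact_UN) auto
  moreover have "closed (\<Inter>i\<in>\<rho>. A i)" using assms by (intro closed_INT) (auto intro: compact_imp_closed)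
  ultimately show ?thesis by (simp add: compact_Int_closed)
qed

text \<open>
  The compact set \<open>convex hull X\<close> has a Lebesgue number for the cover. The points of the hull whose
  distance to the complement of \<open>U i\<close> is at least \<open>d\<close> form \<open>K i\<close>; they still cover the hull if \<open>d\<close> does
  not exceed the Lebesgue number. A possibly smaller \<open>d\<close> keeps every point of \<open>X\<close> in all its sets, so
  that the nerve survives when \<open>X\<close> contains a point for each face.
\<close>

lemma compact_convex_shrinking:
  fixes U :: "'v \<Rightarrow> 'a :: real_normed_vector set"
  assumes V: "finite V" and U: "\<And>i. i \<in> V \<Longrightarrow> open (U i)" "\<And>i. i \<in> V \<Longrightarrow> convex (U i)"
    and X: "finite X" "convex hull X \<subseteq> (\<Union>i\<in>V. U i)"
  obtains K where "\<And>i. i \<in> V \<Longrightarrow> compact (K i)" "\<And>i. i \<in> V \<Longrightarrow> convex (K i)"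
    "\<And>i. i \<in> V \<Longrightarrow> K i \<subseteq> U i" "\<And>i. i \<in> V \<Longrightarrow> X \<inter> U i \<subseteq> K i" "(\<Union>i\<in>V. K i) = convex hull X"
proof -
  define P where "P = convex hull X"
  have P: "compact P" "convex P" "X \<subseteq> P"
    unfolding P_def using X(1) by (auto intro: finite_imp_compact_convex_hull hull_inc)
  obtain e0 where e0: "0 < e0" "\<And>x. x \<in> P \<Longrightarrow> \<exists>G\<in>U ` V. ball x e0 \<subseteq> G"
    by (rule Heine_Borel_lemma[of P "U ` V"]) (use P X(2) U(1) in \<open>auto simp: P_def\<close>)
  define Z where "Z = {(x, i). x \<in> X \<and> i \<in> V \<and> x \<in> U i}"
  have Z: "finite Z" unfolding Z_def by (rule finite_subset[of _ "X \<times> V"]) (use X V in auto)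
  have "\<forall>z\<in>Z. \<exists>e>0. ball (fst z) e \<subseteq> U (snd z)"
    unfolding Z_def using U(1) by (auto simp: open_contains_ball)
  then obtain e where e: "\<And>z. z \<in> Z \<Longrightarrow> e z > 0" "\<And>z. z \<in> Z \<Longrightarrow> ball (fst z) (e z) \<subseteq> U (snd z)"
    by metis
  define d where "d = Min (insert e0 (e ` Z))"
  have d: "d > 0" "d \<le> e0" "\<And>z. z \<in> Z \<Longrightarrow> d \<le> e z"
    using Z e e0 by (auto simp: d_def)
  define K where "K i = {x \<in> P. ball x d \<subseteq> U i}" for i
  show thesis
  proof (rule that[of K])
    fix i assume i: "i \<in> V"
    have "K i = P \<inter> (\<Inter>y\<in>- U i. {x. d \<le> dist x y})"
      by (auto simp: K_def subset_iff simp flip: not_less)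
    moreover have "closed {x. d \<le> dist x y}" for y :: 'a
      by (intro closed_Collect_le continuous_intros)
    ultimately show "compact (K i)" using P(1) by (auto intro!: compact_Int_closed)
    show "convex (K i)"
    proof (rule convexI)
      fix x y and u v :: real
      assume xy: "x \<in> K i" "y \<in> K i" and uv: "0 \<le> u" "0 \<le> v" "u + v = 1"
      have "z \<in> U i" if "z \<in> ball (u *\<^sub>R x + v *\<^sub>R y) d" for z
      proof -
        define b where "b = z - (u *\<^sub>R x + v *\<^sub>R y)"
        have "norm b < d" using that by (simp add: b_def dist_norm norm_minus_commute)
        then have "x + b \<in> U i" "y + b \<in> U i" using xy by (auto simp: K_def dist_norm subset_iff)
        then have "u *\<^sub>R (x + b) + v *\<^sub>R (y + b) \<in> U i" using convexD[OF U(2)[OF i]] uv by blast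
        moreover have "u *\<^sub>R (x + b) + v *\<^sub>R (y + b) = u *\<^sub>R x + v *\<^sub>R y + (u + v) *\<^sub>R b"
          by (simp add: algebra_simps)
        ultimately show ?thesis using uv by (simp add: b_def)
      qed
      moreover have "u *\<^sub>R x + v *\<^sub>R y \<in> P" using convexD[OF P(2)] xy uv by (auto simp: K_def)
      ultimately show "u *\<^sub>R x + v *\<^sub>R y \<in> K i" unfolding K_def by blast
    qed
    show "K i \<subseteq> U i" unfolding K_def using d(1) by auto
    show "X \<inter> U i \<subseteq> K i"
    proof
      fix x assume x: "x \<in> X \<inter> U i"
      then have "(x, i) \<in> Z" using i by (simp add: Z_def)
      with e(2)[OF this] d(3)[OF this] have "ball x d \<subseteq> U i"
        by (metis fst_conv snd_conv subset_ball order_trans)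
      with x P(3) show "x \<in> K i" by (auto simp: K_def)
    qed
  next
    show "(\<Union>i\<in>V. K i) = convex hull X"
    proof
      show "(\<Union>i\<in>V. K i) \<subseteq> convex hull X" by (auto simp: K_def P_def)
      show "convex hull X \<subseteq> (\<Union>i\<in>V. K i)"
      proof
        fix x assume "x \<in> convex hull X"
        then have "x \<in> P" by (simp add: P_def)
        with e0(2) obtain i where "i \<in> V" "ball x e0 \<subseteq> U i" by blast
        with \<open>x \<in> P\<close> d(2) have "i \<in> V" "x \<in> K i" by (auto simp: K_def dest!: subset_ball)
        then show "x \<in> (\<Union>i\<in>V. K i)" by blast
      qed
    qed
  qed
qed

section \<open>Sweeping by a growing ball\<close>

text \<open>
  The local part of the sweep, at the point \<open>p\<close> touched by the growing ball. Moving the witnesses of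
  the premise along segments towards \<open>p\<close> keeps them in their sets and closer to \<open>a\<close> than \<open>p\<close>. Near \<open>p\<close>
  only the sets that contain \<open>p\<close> are left, hence these cover the hull of the moved witnesses, and
  Berge's theorem applies.
\<close>

lemma common_part_closer_than_point:
  fixes K :: "'v \<Rightarrow> 'a :: real_inner set"
  assumes V: "finite V" and K: "\<And>i. i \<in> V \<Longrightarrow> compact (K i)" "\<And>i. i \<in> V \<Longrightarrow> convex (K i)"
    and C: "convex (\<Union>i\<in>V. K i)"
    and p: "p \<in> (\<Union>i\<in>V. K i)"
    and q: "\<And>j. j \<in> V \<Longrightarrow> p \<in> K j \<Longrightarrow>
      common_part V K ({i\<in>V. p \<in> K i} - {j}) \<inter> ball a (dist a p) \<noteq> {}"
  shows "common_part V K {i\<in>V. p \<in> K i} \<inter> ball a (dist a p) \<noteq> {}"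
proof -
  define C where "C = (\<Union>i\<in>V. K i)"
  define \<sigma> where "\<sigma> = {i\<in>V. p \<in> K i}"
  have \<sigma>: "finite \<sigma>" "\<sigma> \<noteq> {}" "\<sigma> \<subseteq> V" using V p by (auto simp: \<sigma>_def)
  have "\<forall>j\<in>\<sigma>. \<exists>x. x \<in> C \<and> (\<forall>i\<in>\<sigma>. i \<noteq> j \<longrightarrow> x \<in> K i) \<and> dist a x < dist a p"
    using q by (fastforce simp: \<sigma>_def C_def common_part_def)
  then obtain q where q: "\<And>j. j \<in> \<sigma> \<Longrightarrow> q j \<in> C" "\<And>i j. j \<in> \<sigma> \<Longrightarrow> i \<in> \<sigma> \<Longrightarrow> i \<noteq> j \<Longrightarrow> q j \<in> K i"
    "\<And>j. j \<in> \<sigma> \<Longrightarrow> dist a (q j) < dist a p"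
    by metis
  have "closed (\<Union>i\<in>V - \<sigma>. K i)" using V K(1) by (auto intro!: closed_UN compact_imp_closed)
  moreover have "p \<notin> (\<Union>i\<in>V - \<sigma>. K i)" by (auto simp: \<sigma>_def)
  ultimately obtain e where e: "e > 0" "ball p e \<inter> (\<Union>i\<in>V - \<sigma>. K i) = {}"
    by (metis (no_types, lifting) ComplI Compl_eq_Diff_UNIV open_Compl open_contains_ball disjoint_eq_subset_Compl)
  define M where "M = Max (insert 0 ((\<lambda>j. dist p (q j)) ` \<sigma>))"
  have M: "M \<ge> 0" "\<And>j. j \<in> \<sigma> \<Longrightarrow> dist p (q j) \<le> M" using \<sigma>(1) unfolding M_def by (intro Max_ge; simp)+
  \<comment> \<open>With this factor the moved witnesses stay in the ball around \<open>p\<close> that misses the sets without \<open>p\<close>.\<close>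
  define t where "t = min 1 (e / (M + 1))"
  have t: "0 < t" "t \<le> 1" using e M by (auto simp: t_def)
  have tM: "t * M < e"
  proof -
    have "t * (M + 1) \<le> e / (M + 1) * (M + 1)"
      using M(1) by (intro mult_right_mono) (simp_all add: t_def)
    then have "t * (M + 1) \<le> e" using M(1) by simp
    with t show ?thesis by (simp add: distrib_left)
  qed
  define r where "r j = (1 - t) *\<^sub>R p + t *\<^sub>R q j" for j
  have r_in: "r j \<in> S" if "convex S" "p \<in> S" "q j \<in> S" for S j
    unfolding r_def using convexD_alt[OF that] t by simp
  have pC: "p \<in> C" using p by (simp add: C_def)
  define X where "X = convex hull (r ` \<sigma>)"
  have "X \<subseteq> C" unfolding X_def
    by (rule hull_minimal) (use r_in[OF _ pC] q(1) C in \<open>auto simp: C_def\<close>)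
  moreover have "X \<subseteq> ball p e"
  proof -
    have "dist p (r j) < e" if "j \<in> \<sigma>" for j
    proof -
      have "p - r j = t *\<^sub>R (p - q j)" by (simp add: r_def algebra_simps)
      then have "dist p (r j) = t * dist p (q j)" using t by (simp add: dist_norm)
      also have "\<dots> \<le> t * M" using M(2)[OF that] t by simp
      finally show ?thesis using tM by simp
    qed
    then show ?thesis unfolding X_def by (intro hull_minimal) auto
  qed
  moreover have X_ball: "X \<subseteq> ball a (dist a p)"
  proof -
    have "dist a (r j) < dist a p" if "j \<in> \<sigma>" for j
    proof -
      have "a - r j = (1 - t) *\<^sub>R (a - p) + t *\<^sub>R (a - q j)" by (simp add: r_def algebra_simps)
      then have "dist a (r j) \<le> norm ((1 - t) *\<^sub>R (a - p)) + norm (t *\<^sub>R (a - q j))"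
        unfolding dist_norm by (metis norm_triangle_ineq)
      also have "\<dots> = (1 - t) * dist a p + t * dist a (q j)" using t by (simp add: dist_norm)
      also have "\<dots> < (1 - t) * dist a p + t * dist a p" using q(3)[OF that] t by simp
      finally show ?thesis by (simp add: algebra_simps)
    qed
    then show ?thesis unfolding X_def by (intro hull_minimal) auto
  qed
  ultimately have "X \<subseteq> (\<Union>i\<in>\<sigma>. K i)" using e(2) unfolding C_def by blast
  then have "X \<inter> (\<Inter>i\<in>\<sigma>. K i) \<noteq> {}"
    unfolding X_def
  proof (intro Berge_intersection)
    show "r j \<in> K i" if "i \<in> \<sigma>" "j \<in> \<sigma>" "i \<noteq> j" for i j
      using that q(2) K(2) by (intro r_in) (auto simp: \<sigma>_def)
    show "closed (K i)" "convex (K i)" if "i \<in> \<sigma>" for i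
      using that \<sigma>(3) K by (auto intro!: compact_imp_closed[of "K i"])
  qed (use \<sigma> in auto)
  then obtain z where z: "z \<in> X" "\<And>i. i \<in> \<sigma> \<Longrightarrow> z \<in> K i" by blast
  have "z \<in> common_part V K \<sigma>"
    using z \<open>X \<subseteq> C\<close> by (auto simp: common_part_def C_def)
  moreover have "z \<in> ball a (dist a p)" using z(1) X_ball by blast
  ultimately show ?thesis unfolding \<sigma>_def by blast
qed

text \<open>
  The ball of radius \<open>r\<close> around \<open>a\<close> is enlarged until it touches the last of the common parts, which
  happens at radius \<open>R\<close>. A minimal face that is touched last is the free face.
\<close>

lemma free_face_avoiding_ball:
  fixes K :: "'v \<Rightarrow> 'a :: real_inner set"
  assumes V: "finite V" and K: "\<And>i. i \<in> V \<Longrightarrow> compact (K i)" "\<And>i. i \<in> V \<Longrightarrow> convex (K i)"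
    and C: "convex (\<Union>i\<in>V. K i)"
    and \<tau>: "\<tau> \<in> nerve_of V K" "common_part V K \<tau> \<inter> ball a r = {}"
    and w: "(\<Union>i\<in>V. K i) \<inter> ball a r \<noteq> {}"
  obtains \<rho> where "free_face (nerve_of V K) \<rho>" "common_part V K \<rho> \<inter> ball a r = {}"
proof -
  let ?N = "nerve_of V K" and ?KK = "common_part V K"
  have KK: "compact (?KK \<rho>)" "convex (?KK \<rho>)" if "\<rho> \<subseteq> V" for \<rho>
    using compact_common_part[OF V K(1) that] convex_common_part[OF C K(2) that] by simp_all
  have "finite ?N" by (rule finite_subset[of _ "Pow V"]) (use V in \<open>auto simp: nerve_of_def\<close>)
  have "\<exists>x\<in>?KK \<rho>. \<forall>y\<in>?KK \<rho>. dist a x \<le> dist a y" if "\<rho> \<in> ?N" for \<rho>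
    using that KK(1)[of \<rho>] by (intro continuous_attains_inf) (auto simp: nerve_of_def intro!: continuous_intros)
  then obtain m where m: "\<And>\<rho>. \<rho> \<in> ?N \<Longrightarrow> m \<rho> \<in> ?KK \<rho>"
      "\<And>\<rho> y. \<rho> \<in> ?N \<Longrightarrow> y \<in> ?KK \<rho> \<Longrightarrow> dist a (m \<rho>) \<le> dist a y"
    by metis
  define R where "R = Max ((\<lambda>\<rho>. dist a (m \<rho>)) ` ?N)"
  have R: "dist a (m \<rho>) \<le> R" if "\<rho> \<in> ?N" for \<rho>
    unfolding R_def using that \<open>finite ?N\<close> by (intro Max_ge) auto
  have "R \<in> (\<lambda>\<rho>. dist a (m \<rho>)) ` ?N"
    unfolding R_def using \<tau> \<open>finite ?N\<close> by (intro Max_in) auto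
  then obtain \<rho>1 where \<rho>1: "\<rho>1 \<in> ?N" "dist a (m \<rho>1) = R" by auto
  define p where "p = m \<rho>1"
  have p: "dist a p = R" "p \<in> ?KK \<rho>1" using \<rho>1 m(1) by (auto simp: p_def)
  have "r \<le> R" using R[OF \<tau>(1)] m(1)[OF \<tau>(1)] \<tau>(2) by fastforce
  define \<sigma> where "\<sigma> = {i\<in>V. p \<in> K i}"
  have "p \<in> ?KK \<sigma>" using p(2) by (auto simp: common_part_def \<sigma>_def)
  have \<sigma>N: "\<sigma> \<in> ?N" using \<open>p \<in> ?KK \<sigma>\<close> by (auto simp: nerve_of_def \<sigma>_def)
  have \<sigma>1: "?KK \<sigma> \<subseteq> ?KK \<rho>1"
    by (rule common_part_antimono) (use \<rho>1 p in \<open>auto simp: \<sigma>_def common_part_def nerve_of_def\<close>)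
  have "?KK \<sigma> \<inter> ball a R = {}"
    using \<sigma>1 m(2)[OF \<rho>1(1)] \<rho>1(2) by fastforce
  then have "\<exists>\<rho>\<subseteq>\<sigma>. ?KK \<rho> \<inter> ball a R = {} \<and> (\<forall>\<rho>'\<subset>\<rho>. ?KK \<rho>' \<inter> ball a R \<noteq> {})"
  proof -
    have "finite \<sigma>" using V by (simp add: \<sigma>_def)
    then have "finite {\<rho> \<in> Pow \<sigma>. ?KK \<rho> \<inter> ball a R = {}}" by simp
    moreover have "\<sigma> \<in> {\<rho> \<in> Pow \<sigma>. ?KK \<rho> \<inter> ball a R = {}}" using \<open>?KK \<sigma> \<inter> ball a R = {}\<close> by simp
    ultimately obtain \<rho> where "\<rho> \<in> {\<rho> \<in> Pow \<sigma>. ?KK \<rho> \<inter> ball a R = {}}"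
      "\<forall>\<rho>'\<in>{\<rho> \<in> Pow \<sigma>. ?KK \<rho> \<inter> ball a R = {}}. \<rho>' \<subseteq> \<rho> \<longrightarrow> \<rho> = \<rho>'"
      using finite_has_minimal2 by (metis (no_types, lifting))
    then show ?thesis by (intro exI[of _ \<rho>]) blast
  qed
  then obtain \<rho> where \<rho>: "\<rho> \<subseteq> \<sigma>" "?KK \<rho> \<inter> ball a R = {}"
    "\<And>\<rho>'. \<rho>' \<subset> \<rho> \<Longrightarrow> ?KK \<rho>' \<inter> ball a R \<noteq> {}" by blast
  have "\<rho> \<subseteq> V" using \<rho>(1) by (auto simp: \<sigma>_def)
  have "p \<in> ?KK \<rho>" using \<open>p \<in> ?KK \<sigma>\<close> by (rule subsetD[OF common_part_antimono[OF \<rho>(1)]])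
  have \<rho>N: "\<rho> \<in> ?N" using \<open>p \<in> ?KK \<rho>\<close> \<open>\<rho> \<subseteq> V\<close> by (auto simp: nerve_of_def)
  \<comment> \<open>A face above \<open>\<rho>\<close> is touched last as well, and its touching point can only be the nearest point \<open>p\<close> of \<open>?KK \<rho>\<close>.\<close>
  have above: "\<rho>' \<subseteq> \<sigma>" if "\<rho>' \<in> ?N" "\<rho> \<subseteq> \<rho>'" for \<rho>'
  proof -
    have "m \<rho>' \<in> ?KK \<rho>" using m(1)[OF that(1)] by (rule subsetD[OF common_part_antimono[OF that(2)]])
    have "m \<rho>' = p"
    proof (rule any_closest_point_unique[where a = a])
      show "\<forall>z\<in>?KK \<rho>. dist a (m \<rho>') \<le> dist a z"
        using R[OF that(1)] \<rho>(2) by fastforce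
      show "\<forall>z\<in>?KK \<rho>. dist a p \<le> dist a z"
        using p(1) \<rho>(2) by fastforce
    qed (use KK[OF \<open>\<rho> \<subseteq> V\<close>] \<open>p \<in> ?KK \<rho>\<close> \<open>m \<rho>' \<in> ?KK \<rho>\<close> in \<open>auto intro: compact_imp_closed\<close>)
    then have "p \<in> ?KK \<rho>'" using m(1)[OF that(1)] by simp
    then show ?thesis using that(1) by (auto simp: common_part_def \<sigma>_def nerve_of_def)
  qed
  have "\<rho> \<noteq> \<sigma>"
  proof
    assume "\<rho> = \<sigma>"
    have "?KK {i\<in>V. p \<in> K i} \<inter> ball a (dist a p) \<noteq> {}"
    proof (rule common_part_closer_than_point[OF V K C])
      show "p \<in> (\<Union>i\<in>V. K i)" using p(2) by (auto simp: common_part_def)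
      fix j assume "j \<in> V" "p \<in> K j"
      then have "{i\<in>V. p \<in> K i} - {j} \<subset> \<rho>" unfolding \<open>\<rho> = \<sigma>\<close> \<sigma>_def by blast
      then show "?KK ({i\<in>V. p \<in> K i} - {j}) \<inter> ball a (dist a p) \<noteq> {}"
        unfolding p(1) by (rule \<rho>(3))
    qed
    then show False using \<open>?KK \<sigma> \<inter> ball a R = {}\<close> p(1) by (simp add: \<sigma>_def)
  qed
  have "facet ?N \<sigma>"
    unfolding facet_def using \<sigma>N above \<rho>(1) by (metis order_trans subset_antisym)
  moreover have "\<phi> = \<sigma>" if "facet ?N \<phi>" "\<rho> \<subseteq> \<phi>" for \<phi>
    using that above \<sigma>N unfolding facet_def by metis
  moreover have "\<not> facet ?N \<rho>"
    using \<rho>(1) \<open>\<rho> \<noteq> \<sigma>\<close> \<sigma>N unfolding facet_def by metis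
  ultimately have "free_face ?N \<rho>"
    unfolding free_face_def using \<rho>N \<rho>(1) by metis
  moreover have "?KK \<rho> \<inter> ball a r = {}" using \<rho>(2) \<open>r \<le> R\<close> subset_ball by blast
  ultimately show thesis by (rule that)
qed

text \<open>
  A ball that separates the hull from the common part of \<open>\<tau>\<close> would yield a free face whose common part
  avoids all the points \<open>x i\<close>, although it lies in some \<open>\<sigma> i\<close>.
\<close>

lemma faces_meet_hull_of_facet_points:
  fixes U :: "'v \<Rightarrow> 'a :: real_inner set" and x :: "'i \<Rightarrow> 'a"
  assumes V: "finite V" and U: "\<And>i. i \<in> V \<Longrightarrow> open (U i)" "\<And>i. i \<in> V \<Longrightarrow> convex (U i)"
    and W: "convex (\<Union>i\<in>V. U i)"
    and I: "finite I" "I \<noteq> {}" and x: "\<And>i. i \<in> I \<Longrightarrow> x i \<in> common_part V U (\<sigma> i)"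
    and \<sigma>: "\<And>i. i \<in> I \<Longrightarrow> \<sigma> i \<subseteq> V"
    and free: "\<And>\<rho>. free_face (nerve_of V U) \<rho> \<Longrightarrow> \<exists>i\<in>I. \<rho> \<subseteq> \<sigma> i"
    and \<tau>: "\<tau> \<in> nerve_of V U"
  shows "common_part V U \<tau> \<inter> convex hull (x ` I) \<noteq> {}"
proof (rule ccontr)
  assume contra: "\<not> ?thesis"
  let ?N = "nerve_of V U"
  have "\<forall>\<rho>\<in>?N. \<exists>y. y \<in> common_part V U \<rho>" by (auto simp: nerve_of_def)
  then obtain y where y: "\<And>\<rho>. \<rho> \<in> ?N \<Longrightarrow> y \<rho> \<in> common_part V U \<rho>" by metis
  \<comment> \<open>One point for each face keeps the nerve when the sets shrink, and the points \<open>x i\<close> stay available.\<close>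
  define X where "X = y ` ?N \<union> x ` I"
  have "finite ?N" by (rule finite_subset[of _ "Pow V"]) (use V in \<open>auto simp: nerve_of_def\<close>)
  then have X: "finite X" using I by (simp add: X_def)
  have XW: "X \<subseteq> (\<Union>i\<in>V. U i)" using x y unfolding X_def common_part_def by blast
  then have hX: "convex hull X \<subseteq> (\<Union>i\<in>V. U i)" by (intro hull_minimal W)
  obtain K where K: "\<And>i. i \<in> V \<Longrightarrow> compact (K i)" "\<And>i. i \<in> V \<Longrightarrow> convex (K i)"
    "\<And>i. i \<in> V \<Longrightarrow> K i \<subseteq> U i" "\<And>i. i \<in> V \<Longrightarrow> X \<inter> U i \<subseteq> K i" "(\<Union>i\<in>V. K i) = convex hull X"
    using compact_convex_shrinking[OF V U X hX] by blast
  have KU: "common_part V K \<rho> \<subseteq> common_part V U \<rho>" if "\<rho> \<subseteq> V" for \<rho>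
    using K(3) that unfolding common_part_def by blast
  have XK: "z \<in> common_part V K \<rho>" if "z \<in> X" "z \<in> common_part V U \<rho>" "\<rho> \<subseteq> V" for z \<rho>
    using that K(4) unfolding common_part_def by blast
  have N: "nerve_of V K = ?N"
  proof
    show "nerve_of V K \<subseteq> ?N"
    proof
      fix \<rho> assume "\<rho> \<in> nerve_of V K"
      then show "\<rho> \<in> ?N" using KU[of \<rho>] by (auto simp: nerve_of_def)
    qed
    show "?N \<subseteq> nerve_of V K"
    proof
      fix \<rho> assume \<rho>: "\<rho> \<in> ?N"
      then have "\<rho> \<subseteq> V" by (simp add: nerve_of_def)
      with \<rho> y XK[of "y \<rho>" \<rho>] show "\<rho> \<in> nerve_of V K" by (auto simp: nerve_of_def X_def)
    qed
  qed
  define D where "D = convex hull (x ` I)"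
  have x_in: "x i \<in> common_part V K (\<sigma> i)" if "i \<in> I" for i
    using XK x \<sigma> that by (simp add: X_def)
  have D: "compact D" "convex D" "D \<noteq> {}"
    using I by (auto simp: D_def intro: finite_imp_compact_convex_hull)
  have \<tau>V: "\<tau> \<subseteq> V" and \<tau>ne: "common_part V K \<tau> \<noteq> {}" using \<tau>[folded N] by (auto simp: nerve_of_def)
  have CK: "convex (\<Union>i\<in>V. K i)" using K(5) by simp
  have disj: "D \<inter> common_part V K \<tau> = {}" using contra KU[OF \<tau>V] by (auto simp: D_def)
  obtain a r where ball: "D \<subseteq> ball a r" "common_part V K \<tau> \<inter> ball a r = {}"
    by (rule compact_convex_separation_by_ball[OF D(1,2) compact_common_part[OF V K(1) \<tau>V]
          convex_common_part[OF CK K(2) \<tau>V] disj D(3) \<tau>ne])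
  have xball: "x i \<in> ball a r" if "i \<in> I" for i
    using ball(1) that unfolding D_def by (meson hull_inc imageI subsetD)
  obtain i0 where "i0 \<in> I" using I(2) by blast
  then have w: "(\<Union>i\<in>V. K i) \<inter> ball a r \<noteq> {}"
    using x_in[of i0] xball[of i0] unfolding common_part_def by blast
  obtain \<rho> where \<rho>: "free_face (nerve_of V K) \<rho>" "common_part V K \<rho> \<inter> ball a r = {}"
    using free_face_avoiding_ball[OF V K(1,2) CK \<tau>[folded N] ball(2) w] by metis
  obtain i where i: "i \<in> I" "\<rho> \<subseteq> \<sigma> i" using free \<rho>(1) unfolding N by metis
  have "x i \<in> common_part V K \<rho>" using x_in[OF i(1)] by (rule subsetD[OF common_part_antimono[OF i(2)]])
  then show False using xball[OF i(1)] \<rho>(2) by blast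
qed

section \<open>Changing the dimension of a representation\<close>

lemma nerve_eq_nerve_of:
  assumes "convex (\<Union>i\<in>V. U i)"
  shows "nerve V U = nerve_of V U"
proof -
  have "nerve_inter V U \<rho> = common_part V U \<rho>" if "\<rho> \<subseteq> V" for \<rho>
    using that convex_hull_eq[THEN iffD2, OF assms] by (auto simp: nerve_inter_def common_part_def)
  then show ?thesis unfolding nerve_def nerve_of_def by blast
qed

text \<open>
  Preimages under this map turn the relatively open convex sets of a representation in dimension \<open>d\<close>
  into open convex sets of the inner product space.
\<close>

definition coords :: "nat \<Rightarrow> fin_seq \<Rightarrow> nat \<Rightarrow> real" where
  "coords d z = (\<lambda>i. if i < d then coord z i else 0)"

lemma Euclidean_space_eq_top_of_set:
  "Euclidean_space d = top_of_set {x. \<forall>i\<ge>d. x i = 0}"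
  by (simp add: Euclidean_space_def euclidean_product_topology)

lemma coords_in_Euclidean_space: "coords d z \<in> {x. \<forall>i\<ge>d. x i = 0}"
  by (simp add: coords_def)

lemma coords_surj:
  assumes "x \<in> {x. \<forall>i\<ge>d. x i = 0}"
  shows "coords d (Fin_seq x) = x"
proof -
  have "{i. x i \<noteq> 0} \<subseteq> {..<d}" using assms by (auto simp: not_le[symmetric])
  then have "coord (Fin_seq x) = x" by (simp add: Fin_seq_inverse finite_subset)
  with assms show ?thesis by (auto simp: coords_def)
qed

lemma linear_coords: "linear (coords d)"
  by (rule linearI)
    (auto simp: coords_def plus_fin_seq.rep_eq scaleR_fin_seq.rep_eq)

lemma open_vimage_coords:
  assumes "openin (Euclidean_space d) S"
  shows "open (coords d -` S)"
proof -
  from assms obtain T where T: "open T" "S = {x. \<forall>i\<ge>d. x i = 0} \<inter> T"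
    by (auto simp: Euclidean_space_eq_top_of_set openin_open)
  have "continuous_on UNIV (coords d)"
  proof (rule continuous_on_coordinatewise_then_product)
    show "continuous_on UNIV (\<lambda>z. coords d z i)" for i
      unfolding coords_def using bounded_linear.continuous_on[OF bounded_linear_coord continuous_on_id]
      by (cases "i < d") auto
  qed
  then have "open (coords d -` T)" using T(1) by (simp add: open_vimage)
  moreover have "coords d -` S = coords d -` T"
    using T(2) coords_in_Euclidean_space by auto
  ultimately show ?thesis by simp
qed

text \<open>
  Reaches the hull of \<open>x 0, \<dots>, x m\<close> with \<open>m\<close> coordinates. The map is not injective when the points are
  affinely dependent, which does no harm as only preimages of sets are taken.
\<close>

definition affine_map :: "nat \<Rightarrow> (nat \<Rightarrow> 'a :: real_vector) \<Rightarrow> (nat \<Rightarrow> real) \<Rightarrow> 'a" where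
  "affine_map m x y = x 0 + (\<Sum>j<m. y j *\<^sub>R (x (Suc j) - x 0))"

lemma affine_map_combination:
  assumes "u + v = 1"
  shows "affine_map m x (u *\<^sub>R y + v *\<^sub>R z) = u *\<^sub>R affine_map m x y + v *\<^sub>R affine_map m x z"
proof -
  have "x 0 = u *\<^sub>R x 0 + v *\<^sub>R x 0" using assms by (metis scaleR_left.add scaleR_one)
  moreover have "(\<Sum>j<m. (u *\<^sub>R y + v *\<^sub>R z) j *\<^sub>R (x (Suc j) - x 0)) =
      u *\<^sub>R (\<Sum>j<m. y j *\<^sub>R (x (Suc j) - x 0)) + v *\<^sub>R (\<Sum>j<m. z j *\<^sub>R (x (Suc j) - x 0))"
    by (simp add: scaleR_add_left sum.distrib scaleR_sum_right)
  ultimately show ?thesis by (simp add: affine_map_def scaleR_add_right)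
qed

lemma convex_vimage_affine_map: "convex S \<Longrightarrow> convex (affine_map m x -` S)"
  by (rule convexI) (auto simp: affine_map_combination convexD)

lemma continuous_affine_map:
  fixes x :: "nat \<Rightarrow> 'a :: real_normed_vector"
  shows "continuous_on UNIV (affine_map m x)"
  unfolding affine_map_def by (intro continuous_intros continuous_on_product_coordinates)

lemma convex_hull_subset_affine_map:
  "convex hull (x ` {..m}) \<subseteq> affine_map m x ` {y. \<forall>i\<ge>m. y i = 0}"
proof (rule hull_minimal)
  show "x ` {..m} \<subseteq> affine_map m x ` {y. \<forall>i\<ge>m. y i = 0}"
  proof (rule image_subsetI)
    fix i assume i: "i \<in> {..m}"
    show "x i \<in> affine_map m x ` {y. \<forall>i\<ge>m. y i = 0}"
    proof (cases i)
      case 0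
      show ?thesis by (rule image_eqI[where x = "\<lambda>j. 0"]) (simp_all add: 0 affine_map_def)
    next
      case (Suc l)
      have "affine_map m x (\<lambda>j. if j = l then 1 else 0) = x i"
        using i by (simp add: Suc affine_map_def if_distrib[of "\<lambda>c. c *\<^sub>R _"] cong: if_cong)
      with i show ?thesis by (intro image_eqI[where x = "\<lambda>j. if j = l then 1 else 0"]) (auto simp: Suc)
    qed
  qed
  show "convex (affine_map m x ` {y. \<forall>i\<ge>m. y i = 0})"
  proof (rule convexI)
    fix a b and u v :: real
    assume "a \<in> affine_map m x ` {y. \<forall>i\<ge>m. y i = 0}" "b \<in> affine_map m x ` {y. \<forall>i\<ge>m. y i = 0}"
      and uv: "0 \<le> u" "0 \<le> v" "u + v = 1"
    then obtain y z where "a = affine_map m x y" "b = affine_map m x z"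
      "\<forall>i\<ge>m. y i = 0" "\<forall>i\<ge>m. z i = 0" by blast
    then show "u *\<^sub>R a + v *\<^sub>R b \<in> affine_map m x ` {y. \<forall>i\<ge>m. y i = 0}"
      by (intro image_eqI[where x = "u *\<^sub>R y + v *\<^sub>R z"])
        (simp_all add: affine_map_combination[OF uv(3)])
  qed
qed

theorem theorem7p1:
  fixes V :: "'v set" and \<Delta> :: "'v set set" and k :: nat and \<sigma> :: "nat \<Rightarrow> 'v set"
  assumes "k \<ge> 1"
    and "simplicial_complex_on V \<Delta>"
    and "convex_union_representable V \<Delta>"
    and "inj_on \<sigma> {1..k}"
    and "\<And>i. i \<in> {1..k} \<Longrightarrow> facet \<Delta> (\<sigma> i)"
    and "\<And>\<tau>. free_face \<Delta> \<tau> \<Longrightarrow> \<exists>i\<in>{1..k}. \<tau> \<subseteq> \<sigma> i"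
  shows "convex_union_representable_dim (k - 1) V \<Delta>"
proof -
  define m where "m = k - 1"
  have V: "finite V" using assms(2) by (simp add: simplicial_complex_on_def)
  obtain d U where U: "\<And>i. i \<in> V \<Longrightarrow> openin (Euclidean_space d) (U i)"
      "\<And>i. i \<in> V \<Longrightarrow> convex (U i)"
    and W: "convex (\<Union>i\<in>V. U i)" and \<Delta>: "\<Delta> = nerve V U"
    using assms(3) unfolding convex_union_representable_def convex_union_representable_dim_def by blast
  define U' where "U' i = coords d -` U i" for i
  have U': "open (U' i)" "convex (U' i)" if "i \<in> V" for i
    using U[OF that] by (simp_all add: U'_def open_vimage_coords convex_linear_vimage linear_coords)
  have W': "convex (\<Union>i\<in>V. U' i)"
    using convex_linear_vimage[OF linear_coords W] by (simp add: U'_def vimage_UN)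
  have part': "common_part V U' \<rho> = coords d -` common_part V U \<rho>" for \<rho>
    by (auto simp: common_part_def U'_def)
  have "(\<Union>i\<in>V. U i) \<subseteq> {x. \<forall>i\<ge>d. x i = 0}"
    using U(1) openin_subset topspace_Euclidean_space by blast
  then have "x \<in> range (coords d)" if "x \<in> common_part V U \<rho>" for x \<rho>
    using coords_surj[of x d] that by (intro range_eqI[where x = "Fin_seq x"]) (auto simp: common_part_def)
  then have "common_part V U' \<rho> \<noteq> {} \<longleftrightarrow> common_part V U \<rho> \<noteq> {}" for \<rho>
    unfolding part' by blast
  then have N': "nerve_of V U' = \<Delta>"
    using \<Delta> nerve_eq_nerve_of[OF W] by (simp add: nerve_of_def)
  have \<sigma>N: "\<sigma> (Suc i) \<in> nerve_of V U'" if "i \<in> {..m}" for i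
    using assms(1) assms(5)[of "Suc i"] that by (auto simp: N' facet_def m_def)
  then have "\<forall>i\<in>{..m}. \<exists>x. x \<in> common_part V U' (\<sigma> (Suc i))"
    unfolding nerve_of_def by blast
  then obtain x where x: "\<And>i. i \<in> {..m} \<Longrightarrow> x i \<in> common_part V U' (\<sigma> (Suc i))" by metis
  have meet: "common_part V U' \<tau> \<inter> convex hull (x ` {..m}) \<noteq> {}" if "\<tau> \<in> \<Delta>" for \<tau>
  proof (rule faces_meet_hull_of_facet_points[where \<sigma> = "\<lambda>i. \<sigma> (Suc i)"])
    show "\<sigma> (Suc i) \<subseteq> V" if "i \<in> {..m}" for i
      using \<sigma>N[OF that] by (simp add: nerve_of_def)
    show "\<exists>i\<in>{..m}. \<rho> \<subseteq> \<sigma> (Suc i)" if "free_face (nerve_of V U') \<rho>" for \<rho>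
    proof -
      obtain i where "i \<in> {1..k}" "\<rho> \<subseteq> \<sigma> i" using assms(6) \<open>free_face _ \<rho>\<close> N' by blast
      then show ?thesis by (intro bexI[of _ "i - 1"]) (auto simp: m_def)
    qed
  qed (use V U' W' x that N' in auto)
  \<comment> \<open>The representation in dimension \<open>m\<close>; a face keeps a nonempty common part since it meets the hull of the \<open>x i\<close>.\<close>
  define U'' where "U'' i = {y. \<forall>i\<ge>m. y i = 0} \<inter> affine_map m x -` U' i" for i
  have E: "convex {y :: nat \<Rightarrow> real. \<forall>i\<ge>m. y i = 0}"
    by (rule convexI) simp
  have W'': "convex (\<Union>i\<in>V. U'' i)"
  proof -
    have "(\<Union>i\<in>V. U'' i) = {y. \<forall>i\<ge>m. y i = 0} \<inter> affine_map m x -` (\<Union>i\<in>V. U' i)"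
      by (auto simp: U''_def)
    then show ?thesis using E W' by (simp add: convex_Int convex_vimage_affine_map)
  qed
  have part'': "common_part V U'' \<rho> = {y. \<forall>i\<ge>m. y i = 0} \<inter> affine_map m x -` common_part V U' \<rho>" for \<rho>
    by (auto simp: common_part_def U''_def)
  have "common_part V U'' \<rho> \<noteq> {} \<longleftrightarrow> common_part V U' \<rho> \<noteq> {}" if "\<rho> \<subseteq> V" for \<rho>
  proof
    assume "common_part V U' \<rho> \<noteq> {}"
    then have "\<rho> \<in> \<Delta>" using that by (auto simp: N'[symmetric] nerve_of_def)
    then obtain z where z: "z \<in> common_part V U' \<rho>" "z \<in> convex hull (x ` {..m})" using meet by blast
    then obtain y where "\<forall>i\<ge>m. y i = 0" "z = affine_map m x y"
      using convex_hull_subset_affine_map[of x m] by blast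
    then show "common_part V U'' \<rho> \<noteq> {}" using z(1) unfolding part'' by blast
  qed (auto simp: part'')
  then have "nerve_of V U'' = \<Delta>" unfolding N'[symmetric] nerve_of_def by blast
  then have "\<Delta> = nerve V U''" by (simp add: nerve_eq_nerve_of[OF W''])
  moreover have "openin (Euclidean_space m) (U'' i)" if "i \<in> V" for i
    unfolding Euclidean_space_eq_top_of_set U''_def
    using U'(1)[OF that] continuous_affine_map by (intro openin_open_Int open_vimage)
  moreover have "convex (U'' i)" if "i \<in> V" for i
    unfolding U''_def using E U'(2)[OF that] by (intro convex_Int convex_vimage_affine_map)
  ultimately show ?thesis
    unfolding convex_union_representable_dim_def m_def[symmetric] using W'' by blast
qed

end
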